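(* With $p_n$ the Askey--Wilson polynomials, $\mathcal{K}_{a,c}$ the integral operator defined in the context, and $x=\cos\theta$, the following transmutation relation holds: $$\begin{aligned} \big(\mathcal{K}_{a,c}\,p_n(\cdot;-1/c,-cq,a_3,a_4)\big)(\cos\theta)={}&q^{a(a-3)/4+na/2}\Big(\frac{1-q}{2c}\Big)^a\frac{(q;q)_n}{(q^{a+1};q)_n}\,\frac{(q^{a+1};q)_\infty}{(q;q)_\infty}\,\frac{h(\cos\theta;-q^{1-a/2}c)}{h(\cos\theta;-cq^{1+a/2})}\\ &\times p_n\big(x;-q^{a/2}/c,\,-cq^{1+a/2},\,q^{-a/2}a_3,\,q^{-a/2}a_4\big). \end{aligned}$$
   Context: Throughout $0<q<1$, $(A;q)_\infty=\prod_{k\ge0}(1-Aq^k)$, $(A;q)_n=\prod_{k=0}^{n-1}(1-Aq^k)$, $(A_1,\dots,A_m;q)_n=\prod_j(A_j;q)_n$ (also for $n=\infty$), ${}_{r+1}\phi_r\big({\alpha_1,\dots,\alpha_{r+1}\atop\beta_1,\dots,\beta_r}\big|q,x\big)=\sum_{k\ge0}\frac{(\alpha_1,\dots,\alpha_{r+1};q)_k}{(q,\beta_1,\dots,\beta_r;q)_k}x^k$, and $h(\cos\theta;a_1,\dots,a_n)=\prod_{j=1}^n(a_je^{i\theta},a_je^{-i\theta};q)_\infty$. The Askey--Wilson polynomials, $n=0,1,2,\dots$, are $$p_n(\cos\theta;t_1,t_2,t_3,t_4)=(t_1t_2,t_1t_3,t_1t_4;q)_n\,t_1^{-n}\,{}_4\phi_3\left(\begin{matrix}q^{-n},q^{n-1}t_1t_2t_3t_4,t_1e^{i\theta},t_1e^{-i\theta}\\t_1t_2,t_1t_3,t_1t_4\end{matrix}\Big|q,q\right).$$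 The normalized continuous $q$-Hermite weight is $w_H(x|q)=\frac{(q,e^{2i\theta},e^{-2i\theta};q)_\infty}{2\pi\sqrt{1-x^2}}$, $x=\cos\theta$. For $a>0$ and a parameter $c$, $$(\mathcal{K}_{a,c}f)(\cos\theta)=q^{a(a-3)/4}\Big(\frac{1-q}{2c}\Big)^a h(\cos\theta;-cq^{1-a/2},-q^{a/2}/c)\int_0^\pi\frac{w_H(\cos\phi|q)\,(q^a;q)_\infty\, f(\cos\phi)\sin\phi\,d\phi}{h(\cos\phi;q^{a/2}e^{i\theta},q^{a/2}e^{-i\theta})\,h(\cos\phi;-1/c,-cq)} .$$
   Formalization: The parameter c is restricted to complex values with 1<|c|<1/q: outside the closed annulus the identity fails (already for n=0), and on its boundary the integral diverges for non-real c; the limiting points c=±1, ±1/q are not covered. *)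

theory Defs
  imports "HOL-Analysis.Analysis"
begin

definition qpoch :: "complex \<Rightarrow> real \<Rightarrow> nat \<Rightarrow> complex" where
  "qpoch A q n = (\<Prod>k<n. 1 - A * of_real q ^ k)"

definition qpoch_inf :: "complex \<Rightarrow> real \<Rightarrow> complex" where
  "qpoch_inf A q = (\<Prod>k. 1 - A * of_real q ^ k)"

definition qpochs :: "complex list \<Rightarrow> real \<Rightarrow> nat \<Rightarrow> complex" where
  "qpochs As q n = (\<Prod>A\<leftarrow>As. qpoch A q n)"

definition qpochs_inf :: "complex list \<Rightarrow> real \<Rightarrow> complex" where
  "qpochs_inf As q = (\<Prod>A\<leftarrow>As. qpoch_inf A q)"

definition basic_hyp :: "complex list \<Rightarrow> complex list \<Rightarrow> real \<Rightarrow> complex \<Rightarrow> complex" where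
  "basic_hyp \<alpha>s \<beta>s q x =
     (\<Sum>k. qpochs \<alpha>s q k / qpochs (of_real q # \<beta>s) q k * x ^ k)"

text \<open>Functions of \<open>cos \<theta>\<close> are functions of a real \<open>x\<close> in \<open>[-1, 1]\<close>, evaluated
  with \<open>\<theta> = arccos x\<close>. The defining expressions are invariant under \<open>\<theta> \<mapsto> -\<theta>\<close> and
  \<open>\<theta> \<mapsto> \<theta> + 2 * pi\<close>, so this choice of \<open>\<theta>\<close> is immaterial.\<close>

definition h_fun :: "real \<Rightarrow> real \<Rightarrow> complex list \<Rightarrow> complex" where
  "h_fun q x ts = (let \<theta> = arccos x in
     (\<Prod>t\<leftarrow>ts. qpochs_inf [t * cis \<theta>, t * cis (- \<theta>)] q))"

text \<open>As usual for this normalization, the hypergeometric representation presupposes that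
  \<open>t1\<close> is nonzero and that none of \<open>t1 * t2\<close>, \<open>t1 * t3\<close>, \<open>t1 * t4\<close> is one of
  \<open>1, 1/q, \<dots>, 1/q^(n-1)\<close>; at such exceptional parameters the leading factor, hence the
  whole expression, is \<open>0\<close> under the convention \<open>y / 0 = 0\<close>. The series terminates
  because of the numerator parameter \<open>1/q^n\<close>.\<close>

definition askey_wilson ::
  "real \<Rightarrow> nat \<Rightarrow> complex \<Rightarrow> complex \<Rightarrow> complex \<Rightarrow> complex \<Rightarrow> real \<Rightarrow> complex" where
  "askey_wilson q n t1 t2 t3 t4 x = (let \<theta> = arccos x in
     qpochs [t1 * t2, t1 * t3, t1 * t4] q n * t1 powi (- int n) *
     basic_hyp
       [of_real q powi (- int n), of_real q powi (int n - 1) * t1 * t2 * t3 * t4,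
        t1 * cis \<theta>, t1 * cis (- \<theta>)]
       [t1 * t2, t1 * t3, t1 * t4] q (of_real q))"

definition w_H :: "real \<Rightarrow> real \<Rightarrow> complex" where
  "w_H q x = (let \<theta> = arccos x in
     qpochs_inf [of_real q, cis (2 * \<theta>), cis (- 2 * \<theta>)] q / of_real (2 * pi * sqrt (1 - x\<^sup>2)))"

text \<open>The power with base \<open>(1 - q) / (2 * c)\<close> is the principal one; for \<open>c > 0\<close> it is the
  ordinary real power.\<close>

definition K_op :: "real \<Rightarrow> real \<Rightarrow> complex \<Rightarrow> (real \<Rightarrow> complex) \<Rightarrow> real \<Rightarrow> complex" where
  "K_op q a c f x = (let \<theta> = arccos x in
     of_real (q powr (a * (a - 3) / 4)) * (of_real (1 - q) / (2 * c)) powr of_real a *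
     h_fun q x [- c * of_real (q powr (1 - a / 2)), - of_real (q powr (a / 2)) / c] *
     integral {0..pi} (\<lambda>\<phi>.
       w_H q (cos \<phi>) * qpoch_inf (of_real (q powr a)) q * f (cos \<phi>) * of_real (sin \<phi>) /
       (h_fun q (cos \<phi>) [of_real (q powr (a / 2)) * cis \<theta>, of_real (q powr (a / 2)) * cis (- \<theta>)] *
        h_fun q (cos \<phi>) [- 1 / c, - c * of_real q])))"

end

(* After expanding p_n, each term multiplies the weight by (t1 e^{i phi}, t1 e^{-i phi}; q)_k,
   which replaces t1 by t1 q^k in the denominator; so every term is an Askey-Wilson integral.
   As t1 t2 = q, the factor (t1 t2; q)_k of the series cancels, and what remains is the 4phi3 of
   the polynomial on the right-hand side.

   The Askey-Wilson integral I(a,b,c,d) is evaluated through the contiguous relation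
   (1 - abcd) I(qa,b,c,d) = (1-ab)(1-ac)(1-ad) I(a,b,c,d): the difference of the integrands is
   F(q^{1/2} z) - F(q^{-1/2} z) for a function F that is holomorphic on the annulus between the
   two circles. Iteration moves all parameters to 0, and the remaining constant I(0,0,0,0) is read
   off from the parameters q, -q, q^{1/2}, -q^{1/2}, for which the weight is (1 - z^2)(1 - z^{-2}). *)

theory Submission
  imports Defs "HOL-Complex_Analysis.Cauchy_Integral_Formula"
begin

section \<open>Infinite q-shifted factorials\<close>

lemma qpoch_0 [simp]: "qpoch A q 0 = 1"
  and qpoch_Suc: "qpoch A q (Suc n) = qpoch A q n * (1 - A * of_real q ^ n)"
  by (simp_all add: qpoch_def)

lemma qpoch_inf_0 [simp]: "qpoch_inf 0 q = 1"
  by (simp add: qpoch_inf_def)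

context
  fixes q :: real
  assumes q0: "0 < q" and q1: "q < 1"
begin

lemma convergent_prod_qpoch: "convergent_prod (\<lambda>k. 1 - A * of_real q ^ k :: complex)"
proof -
  have "summable (\<lambda>k. norm A * q ^ k)"
    using q0 q1 by (intro summable_mult summable_geometric) auto
  then have "abs_convergent_prod (\<lambda>k. 1 - A * of_real q ^ k :: complex)"
    using q0 by (intro summable_imp_abs_convergent_prod) (simp add: norm_mult norm_power)
  then show ?thesis
    by (rule abs_convergent_prod_imp_convergent_prod)
qed

lemma qpoch_tendsto_qpoch_inf: "(\<lambda>n. qpoch A q n) \<longlonglongrightarrow> qpoch_inf A q"
proof -
  have "(\<lambda>n. qpoch A q (Suc n)) \<longlonglongrightarrow> qpoch_inf A q"
    using convergent_prod_LIMSEQ[OF convergent_prod_qpoch[of A]]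
    by (simp add: qpoch_def qpoch_inf_def lessThan_Suc_atMost)
  then show ?thesis
    by (rule LIMSEQ_imp_Suc)
qed

lemma qpoch_add: "qpoch A q (m + n) = qpoch A q m * qpoch (A * of_real q ^ m) q n"
  by (induction n) (simp_all add: qpoch_Suc power_add mult_ac)

lemma qpoch_inf_split: "qpoch_inf A q = qpoch A q m * qpoch_inf (A * of_real q ^ m) q"
proof (rule LIMSEQ_unique)
  show "(\<lambda>n. qpoch A q (m + n)) \<longlonglongrightarrow> qpoch_inf A q"
    using LIMSEQ_ignore_initial_segment[OF qpoch_tendsto_qpoch_inf[of A], of m] by (simp add: add.commute)
  show "(\<lambda>n. qpoch A q (m + n)) \<longlonglongrightarrow> qpoch A q m * qpoch_inf (A * of_real q ^ m) q"
    unfolding qpoch_add by (intro tendsto_intros qpoch_tendsto_qpoch_inf)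
qed

lemma qpoch_inf_step: "qpoch_inf A q = (1 - A) * qpoch_inf (A * of_real q) q"
  using qpoch_inf_split[of A 1] by (simp add: qpoch_def)

lemma mult_power_neq_1:
  assumes "norm A < 1"
  shows "1 - A * of_real q ^ k \<noteq> (0 :: complex)"
proof
  assume "1 - A * of_real q ^ k = 0"
  then have "norm (A * of_real q ^ k) = 1"
    by simp
  moreover have "norm A * q ^ k \<le> norm A"
    using q0 q1 by (intro mult_left_le power_le_one) auto
  ultimately show False
    using assms q0 by (simp add: norm_mult norm_power)
qed

lemma qpoch_nonzero: "norm A < 1 \<Longrightarrow> qpoch A q n \<noteq> 0"
  using mult_power_neq_1 by (simp add: qpoch_def)

lemma qpoch_inf_nonzero: "norm A < 1 \<Longrightarrow> qpoch_inf A q \<noteq> 0"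
  unfolding qpoch_inf_def using mult_power_neq_1 by (intro prodinf_nonzero convergent_prod_qpoch) auto

lemma uniform_limit_qpoch:
  "uniform_limit (cball 0 R) (\<lambda>n A. qpoch A q n) (\<lambda>A. qpoch_inf A q) sequentially"
proof -
  have "uniformly_convergent_on (cball 0 R) (\<lambda>n A. \<Prod>k<n. 1 - A * of_real q ^ k :: complex)"
  proof (rule uniformly_convergent_on_prod')
    show "uniformly_convergent_on (cball 0 R) 
        (\<lambda>N A. \<Sum>n<N. norm (1 - A * of_real q ^ n - 1 :: complex))"
    proof (rule Weierstrass_m_test')
      show "norm (norm (1 - A * of_real q ^ n - 1)) \<le> R * q ^ n" if "A \<in> cball 0 R" for n and A :: complex
        using that q0 by (auto simp: norm_mult norm_power intro!: mult_right_mono)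
      show "summable (\<lambda>n. R * q ^ n)"
        using q0 q1 by (intro summable_mult summable_geometric) auto
    qed
  qed (auto intro!: continuous_intros)
  then obtain g where g: "uniform_limit (cball 0 R) (\<lambda>n A. qpoch A q n) g sequentially"
    unfolding uniformly_convergent_on_def qpoch_def by blast
  have "g A = qpoch_inf A q" if "A \<in> cball 0 R" for A
    using tendsto_uniform_limitI[OF g that] qpoch_tendsto_qpoch_inf LIMSEQ_unique by blast
  with g show ?thesis
    by (subst uniform_limit_cong') auto
qed

lemma holomorphic_qpoch_inf: "(\<lambda>A. qpoch_inf A q) holomorphic_on UNIV"
proof (rule holomorphic_uniform_sequence)
  show "(\<lambda>A. qpoch A q n) holomorphic_on UNIV" for n
    unfolding qpoch_def by (intro holomorphic_intros)
  show "\<exists>d>0. cball x d \<subseteq> UNIV \<and> uniform_limit (cball x d) (\<lambda>n A. qpoch A q n) (\<lambda>A. qpoch_inf A q) sequentially"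
    for x :: complex
  proof (intro exI conjI)
    show "uniform_limit (cball x 1) (\<lambda>n A. qpoch A q n) (\<lambda>A. qpoch_inf A q) sequentially"
      by (rule uniform_limit_on_subset[OF uniform_limit_qpoch[of "norm x + 1"]])
        (simp add: subset_iff dist_norm, smt (verit) norm_minus_commute norm_triangle_sub)
  qed auto
qed auto

lemma holomorphic_on_qpoch_inf:
  "f holomorphic_on S \<Longrightarrow> (\<lambda>z. qpoch_inf (f z) q) holomorphic_on S"
  using holomorphic_on_compose_gen[OF _ holomorphic_qpoch_inf, of f S] by (simp add: o_def)

lemma continuous_on_qpoch_inf:
  "continuous_on S f \<Longrightarrow> continuous_on S (\<lambda>z. qpoch_inf (f z) q)"
  using continuous_on_compose2[OF holomorphic_on_imp_continuous_on[OF holomorphic_qpoch_inf], of S f] by simp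

lemma qpoch_inf_minus: "qpoch_inf A q * qpoch_inf (- A) q = qpoch_inf (A\<^sup>2) (q\<^sup>2)"
proof -
  have "qpoch_inf A q * qpoch_inf (- A) q = (\<Prod>k. (1 - A * of_real q ^ k) * (1 - (- A) * of_real q ^ k))"
    unfolding qpoch_inf_def by (intro prodinf_mult convergent_prod_qpoch)
  also have "\<dots> = qpoch_inf (A\<^sup>2) (q\<^sup>2)"
    unfolding qpoch_inf_def
    by (intro prodinf_cong) (simp add: algebra_simps power2_eq_square power_mult_distrib)
  finally show ?thesis .
qed

end

lemma qpoch_inf_even_odd:
  assumes "0 < q" "q < 1"
  shows "qpoch_inf A q = qpoch_inf A (q\<^sup>2) * qpoch_inf (A * of_real q) (q\<^sup>2)"
proof (rule LIMSEQ_unique)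
  have q2: "0 < q\<^sup>2" "q\<^sup>2 < 1"
    using assms by (auto simp: power_less_one_iff)
  have eq: "qpoch A q (2 * n) = qpoch A (q\<^sup>2) n * qpoch (A * of_real q) (q\<^sup>2) n" for n
    by (induction n) (simp_all add: qpoch_Suc power_mult mult_ac power_mult_distrib flip: power_mult)
  show "(\<lambda>n. qpoch A q (2 * n)) \<longlonglongrightarrow> qpoch_inf A q"
    using LIMSEQ_subseq_LIMSEQ[OF qpoch_tendsto_qpoch_inf[OF assms, of A], of "\<lambda>n. 2 * n"]
    by (simp add: strict_mono_def o_def)
  show "(\<lambda>n. qpoch A q (2 * n)) \<longlonglongrightarrow> qpoch_inf A (q\<^sup>2) * qpoch_inf (A * of_real q) (q\<^sup>2)"
    unfolding eq by (intro tendsto_intros qpoch_tendsto_qpoch_inf q2)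
qed

lemma euler_qpoch_inf:
  assumes "0 < q" "q < 1"
  shows "qpoch_inf (- of_real q) q * qpoch_inf (of_real q) (q\<^sup>2) = 1"
proof -
  have "qpoch_inf (of_real q) q * (qpoch_inf (- of_real q) q * qpoch_inf (of_real q) (q\<^sup>2)) = qpoch_inf (of_real q) q"
    using qpoch_inf_even_odd[OF assms, of "of_real q"] qpoch_inf_minus[OF assms, of "of_real q"]
    by (simp add: power2_eq_square mult_ac)
  then show ?thesis
    using qpoch_inf_nonzero[OF assms, of "of_real q"] assms by simp
qed

section \<open>The Askey-Wilson integral\<close>

lemma circle_integral_eq:
  assumes "open S" and F: "F holomorphic_on S"
    and r: "0 < r" "r \<le> R"
    and sub: "\<And>z. r \<le> norm z \<Longrightarrow> norm z \<le> R \<Longrightarrow> z \<in> S"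
  shows "integral {-pi..pi} (\<lambda>t. F (of_real r * cis t)) = integral {-pi..pi} (\<lambda>t. F (of_real R * cis t))"
proof -
  have *: "contour_integral (part_circlepath 0 \<rho> (-pi) pi) (\<lambda>z. F z / z) =
      \<i> * integral {-pi..pi} (\<lambda>t. F (of_real \<rho> * cis t))" if "\<rho> > 0" for \<rho>
  proof -
    have "contour_integral (part_circlepath 0 \<rho> (-pi) pi) (\<lambda>z. F z / z) =
        integral {-pi..pi} (\<lambda>t. \<i> * F (of_real \<rho> * cis t))"
      using that by (subst contour_integral_part_circlepath_eq) (auto intro!: integral_cong)
    then show ?thesis
      by simp
  qed
  have "homotopic_loops (S - {0}) (part_circlepath 0 r (-pi) pi) (part_circlepath 0 R (-pi) pi)"
  proof (rule homotopic_loops_linear)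
    fix t :: real
    show "closed_segment (part_circlepath 0 r (-pi) pi t) (part_circlepath 0 R (-pi) pi t) \<subseteq> S - {0}"
    proof
      fix w assume "w \<in> closed_segment (part_circlepath 0 r (-pi) pi t) (part_circlepath 0 R (-pi) pi t)"
      then obtain u where u: "0 \<le> u" "u \<le> 1"
        and "w = (1 - u) *\<^sub>R part_circlepath 0 r (-pi) pi t + u *\<^sub>R part_circlepath 0 R (-pi) pi t"
        unfolding closed_segment_def by auto
      then have w: "w = of_real ((1 - u) * r + u * R) * cis (linepath (-pi) pi t)"
        by (simp add: part_circlepath_def cis_conv_exp scaleR_conv_of_real algebra_simps)
      have "r \<le> (1 - u) * r + u * R"
        using u r mult_left_mono[of r R u] by (simp add: algebra_simps)
      moreover have "(1 - u) * r + u * R \<le> R"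
        using u r mult_left_mono[of r R "1 - u"] by (simp add: algebra_simps)
      moreover have "norm w = \<bar>(1 - u) * r + u * R\<bar>"
        unfolding w norm_mult norm_of_real by simp
      ultimately show "w \<in> S - {0}"
        using sub[of w] r by auto
    qed
  qed (simp_all add: cis_conv_exp[symmetric] exp_minus)
  moreover have "(\<lambda>z. F z / z) holomorphic_on S - {0}"
    by (intro holomorphic_intros holomorphic_on_subset[OF F]) auto
  ultimately have "contour_integral (part_circlepath 0 r (-pi) pi) (\<lambda>z. F z / z) =
      contour_integral (part_circlepath 0 R (-pi) pi) (\<lambda>z. F z / z)"
    using \<open>open S\<close> by (intro Cauchy_theorem_homotopic_loops[of "S - {0}"]) auto
  then show ?thesis
    unfolding *[OF r(1)] *[OF less_le_trans[OF r]] by simp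
qed

definition aw_weight :: "real \<Rightarrow> complex \<Rightarrow> complex \<Rightarrow> complex \<Rightarrow> complex \<Rightarrow> complex \<Rightarrow> complex" where
  "aw_weight q a b c d z = qpoch_inf (z\<^sup>2) q * qpoch_inf (1 / z\<^sup>2) q /
     (qpoch_inf (a * z) q * qpoch_inf (a / z) q * (qpoch_inf (b * z) q * qpoch_inf (b / z) q) *
     (qpoch_inf (c * z) q * qpoch_inf (c / z) q) * (qpoch_inf (d * z) q * qpoch_inf (d / z) q))"

definition aw_integral :: "real \<Rightarrow> complex \<Rightarrow> complex \<Rightarrow> complex \<Rightarrow> complex \<Rightarrow> complex" where
  "aw_integral q a b c d = integral {-pi..pi} (\<lambda>t. aw_weight q a b c d (cis t))"

lemma aw_weight_perm:
  "aw_weight q a b c d z = aw_weight q b a c d z"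
  "aw_weight q a b c d z = aw_weight q c b a d z"
  "aw_weight q a b c d z = aw_weight q d b c a z"
proof -
  have perm: "A * B * C * D = B * A * C * D" "A * B * C * D = C * B * A * D" "A * B * C * D = D * B * C * A"
    for A B C D :: complex
    by (simp_all only: mult_ac)
  show "aw_weight q a b c d z = aw_weight q b a c d z"
    unfolding aw_weight_def by (subst perm(1)) (rule refl)
  show "aw_weight q a b c d z = aw_weight q c b a d z"
    unfolding aw_weight_def by (subst perm(2)) (rule refl)
  show "aw_weight q a b c d z = aw_weight q d b c a z"
    unfolding aw_weight_def by (subst perm(3)) (rule refl)
qed

lemma aw_integral_perm:
  "aw_integral q a b c d = aw_integral q b a c d"
  "aw_integral q a b c d = aw_integral q c b a d"
  "aw_integral q a b c d = aw_integral q d b c a"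
  unfolding aw_integral_def by (rule integral_cong, rule aw_weight_perm)+

context
  fixes q :: real
  assumes q0: "0 < q" and q1: "q < 1"
begin

lemma continuous_on_aw_weight:
  assumes "norm b < 1" "norm c < 1" "norm d < 1"
  shows "continuous_on (ball 0 1 \<times> cbox (-pi) pi) (\<lambda>(a, t). aw_weight q a b c d (cis t))"
proof -
  have nz: "qpoch_inf (e * cis t) q \<noteq> 0" "qpoch_inf (e / cis t) q \<noteq> 0" if "norm e < 1" for e t
    by (intro qpoch_inf_nonzero[OF q0 q1]; use that in \<open>simp add: norm_mult norm_divide\<close>)+
  have cont: "continuous_on S (\<lambda>p. qpoch_inf (f p * cis (snd p)) q)"
      "continuous_on S (\<lambda>p. qpoch_inf (f p / cis (snd p)) q)"
    if "continuous_on S f" for S and f :: "complex \<times> real \<Rightarrow> complex"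
    by (rule continuous_on_qpoch_inf[OF q0 q1], intro continuous_intros that; simp)+
  have cont': "continuous_on S (\<lambda>p. qpoch_inf ((cis (snd p))\<^sup>2) q)"
      "continuous_on S (\<lambda>p. qpoch_inf (1 / (cis (snd p))\<^sup>2) q)" for S :: "(complex \<times> real) set"
    by (rule continuous_on_qpoch_inf[OF q0 q1], intro continuous_intros; simp)+
  show ?thesis
    unfolding aw_weight_def case_prod_unfold using assms
    by (intro continuous_on_divide continuous_on_mult cont cont' continuous_on_fst continuous_on_const continuous_on_id)
      (auto simp: nz mem_Times_iff)
qed

lemma aw_weight_integrable:
  assumes "norm a < 1" "norm b < 1" "norm c < 1" "norm d < 1"
  shows "(\<lambda>t. aw_weight q a b c d (cis t)) integrable_on {-pi..pi}"
proof -
  have "continuous_on (cbox (-pi) pi) (\<lambda>t. aw_weight q a b c d (cis t))"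
    using continuous_on_compose2[OF continuous_on_aw_weight[OF assms(2-4)], of "cbox (-pi) pi" "\<lambda>t. (a, t)"] assms(1)
    by (auto simp: continuous_on_Pair image_subset_iff)
  then show ?thesis
    using integrable_continuous_interval by auto
qed

lemma continuous_on_aw_integral:
  assumes "norm b < 1" "norm c < 1" "norm d < 1"
  shows "continuous_on (ball 0 1) (\<lambda>a. aw_integral q a b c d)"
  using integral_continuous_on_param[OF continuous_on_aw_weight[OF assms]]
  by (simp add: aw_integral_def)


end

lemma aw_contour_identity:
  fixes a b c d z x :: complex
  assumes zx: "z * x = 1"
  shows "(1 - a * b * c * d) * ((1 - a * z) * (1 - a * x)) - (1 - a * b) * (1 - a * c) * (1 - a * d) =
      - a * ((1 - a * b * c * d) * (z + x) - (a + b + c + d - (a * b * c + a * b * d + a * c * d + b * c * d)))" 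
    (is ?A)
  and "x * (1 - x\<^sup>2) * ((1 - a * z) * (1 - b * z) * (1 - c * z) * (1 - d * z)) +
      z * (1 - z\<^sup>2) * ((1 - a * x) * (1 - b * x) * (1 - c * x) * (1 - d * x)) =
      (1 - z\<^sup>2) * (1 - x\<^sup>2) * ((1 - a * b * c * d) * (z + x) - (a + b + c + d - (a * b * c + a * b * d + a * c * d + b * c * d)))"
    (is ?B)
proof -
  show ?A
    using zx by algebra
  define e1 where "e1 = a + b + c + d"
  define e2 where "e2 = a * b + a * c + a * d + b * c + b * d + c * d"
  define e3 where "e3 = a * b * c + a * b * d + a * c * d + b * c * d"
  define e4 where "e4 = a * b * c * d"
  have expand: "(1 - a * y) * (1 - b * y) * (1 - c * y) * (1 - d * y) = 1 - e1 * y + e2 * y\<^sup>2 - e3 * y^3 + e4 * y^4" for y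
    unfolding e1_def e2_def e3_def e4_def by algebra
  define w where "w = (1 - z\<^sup>2) * (1 - x\<^sup>2)"
  have w: "w = 2 - z\<^sup>2 - x\<^sup>2"
    unfolding w_def using zx by algebra
  have coeffs: "x * (1 - x\<^sup>2) + z * (1 - z\<^sup>2) = w * (z + x)"
      "x * (1 - x\<^sup>2) * z + z * (1 - z\<^sup>2) * x = w"
      "x * (1 - x\<^sup>2) * z\<^sup>2 + z * (1 - z\<^sup>2) * x\<^sup>2 = 0"
      "x * (1 - x\<^sup>2) * z^3 + z * (1 - z\<^sup>2) * x^3 = - w"
      "x * (1 - x\<^sup>2) * z^4 + z * (1 - z\<^sup>2) * x^4 = - w * (z + x)"
    unfolding w using zx by algebra+
  have "x * (1 - x\<^sup>2) * (1 - e1 * z + e2 * z\<^sup>2 - e3 * z^3 + e4 * z^4) +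
      z * (1 - z\<^sup>2) * (1 - e1 * x + e2 * x\<^sup>2 - e3 * x^3 + e4 * x^4) =
      (x * (1 - x\<^sup>2) + z * (1 - z\<^sup>2)) - e1 * (x * (1 - x\<^sup>2) * z + z * (1 - z\<^sup>2) * x) +
      e2 * (x * (1 - x\<^sup>2) * z\<^sup>2 + z * (1 - z\<^sup>2) * x\<^sup>2) - e3 * (x * (1 - x\<^sup>2) * z^3 + z * (1 - z\<^sup>2) * x^3) +
      e4 * (x * (1 - x\<^sup>2) * z^4 + z * (1 - z\<^sup>2) * x^4)"
    by (simp only: ring_distribs mult_ac add_ac mult_1_left mult_1_right diff_conv_add_uminus minus_add_distrib
      mult_minus_left mult_minus_right minus_minus)
  also have "\<dots> = w * ((1 - e4) * (z + x) - (e1 - e3))"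
    unfolding coeffs by (simp add: algebra_simps)
  finally show ?B
    unfolding expand by (simp only: e1_def e3_def e4_def w_def)
qed

(* The function F of the contour shift, with s = q^{1/2}: for parameters in the open unit disc it
   is holomorphic near s \<le> |z| \<le> 1/s, the zeros of (z^2, z^{-2}; q)_oo at z = 1, -1 being
   divided by z - 1/z. *)
definition aw_potential :: "real \<Rightarrow> real \<Rightarrow> complex \<Rightarrow> complex \<Rightarrow> complex \<Rightarrow> complex \<Rightarrow> complex \<Rightarrow> complex" where
  "aw_potential q s a b c d z =
     (z - 1 / z) * (qpoch_inf (of_real q * z\<^sup>2) q * qpoch_inf (of_real q / z\<^sup>2) q) /
     (qpoch_inf (s * a * z) q * qpoch_inf (s * a / z) q * (qpoch_inf (s * b * z) q * qpoch_inf (s * b / z) q) *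
     (qpoch_inf (s * c * z) q * qpoch_inf (s * c / z) q) * (qpoch_inf (s * d * z) q * qpoch_inf (s * d / z) q))"

context
  fixes q :: real
  assumes q0: "0 < q" and q1: "q < 1"
begin

lemma aw_weight_shift:
  fixes a b c d z :: complex and s :: real
  assumes ab: "norm a < 1" "norm b < 1" "norm c < 1" "norm d < 1" and z: "norm z = 1"
    and s: "s > 0" "s\<^sup>2 = q"
  shows "(1 - a * b * c * d) * aw_weight q (a * of_real q) b c d z -
      (1 - a * b) * (1 - a * c) * (1 - a * d) * aw_weight q a b c d z =
    a * s * (aw_potential q s a b c d (of_real s * z) - aw_potential q s a b c d (of_real (1 / s) * z))"
proof -
  define x where "x = 1 / z"
  have "z \<noteq> 0" using z by auto
  then have zx: "z * x = 1" by (simp add: x_def)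
  have norm_x: "norm x = 1"
    using z by (simp add: x_def norm_divide)
  define u v where "u = qpoch_inf (of_real q * z\<^sup>2) q" and "v = qpoch_inf (of_real q * x\<^sup>2) q"
  define E where "E e y = qpoch_inf (e * y * of_real q) q" for e y
  have split: "qpoch_inf (e * y) q = (1 - e * y) * E e y" for e y
    unfolding E_def by (rule qpoch_inf_step[OF q0 q1])
  have nz: "1 - e * y \<noteq> 0" "E e y \<noteq> 0" if "norm e < 1" "norm y = 1" for e y
    using qpoch_inf_nonzero[OF q0 q1, of "e * y"] that unfolding split by (auto simp: norm_mult)
  define K where "K = u * v / (E a z * E a x * (E b z * E b x) * (E c z * E c x) * (E d z * E d x))"
  define Q where "Q y = (1 - a * y) * (1 - b * y) * (1 - c * y) * (1 - d * y)" for y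
  have Q: "Q z \<noteq> 0" "Q x \<noteq> 0"
    unfolding Q_def using nz(1) ab z norm_x by simp_all
  have zz: "qpoch_inf (z\<^sup>2) q = (1 - z\<^sup>2) * u" "qpoch_inf (1 / z\<^sup>2) q = (1 - x\<^sup>2) * v"
    unfolding u_def v_def by (subst qpoch_inf_step[OF q0 q1]; simp add: x_def power_divide mult.commute)+
  have ez: "e / z = e * x" for e
    by (simp add: x_def)
  have W: "aw_weight q a b c d z = K * ((1 - z\<^sup>2) * (1 - x\<^sup>2)) / (Q z * Q x)"
    unfolding aw_weight_def zz ez split K_def Q_def
    by (simp only: times_divide_eq_left times_divide_eq_right divide_divide_eq_left mult_ac)
  have cancel: "N / (X * Y * B * C * D) = p * r * (N / (p * X * (r * Y) * B * C * D))"
    if "p \<noteq> 0" "r \<noteq> 0" for p r N X Y B C D :: complex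
    using that by simp
  have shift: "qpoch_inf (a * of_real q * y) q = E a y" for y
    by (simp add: E_def mult_ac)
  have Wq: "aw_weight q (a * of_real q) b c d z = (1 - a * z) * (1 - a * x) * aw_weight q a b c d z"
    unfolding aw_weight_def ez shift split[of a] using nz(1)[OF ab(1) z] nz(1)[OF ab(1) norm_x]
    by (rule cancel)
  have ss: "of_real s * of_real s = (of_real q :: complex)" "of_real s \<noteq> (0 :: complex)"
    using s by (auto simp: power2_eq_square simp flip: of_real_mult)
  have F1: "aw_potential q s a b c d (of_real s * z) = - (x / s * (1 - x\<^sup>2) * K / Q x)"
  proof -
    have "qpoch_inf (of_real q * (of_real s * z)\<^sup>2) q * (1 - of_real q * z\<^sup>2) = u"
      unfolding u_def by (subst (2) qpoch_inf_step[OF q0 q1]) (simp add: power2_eq_square ss mult_ac flip: ss(1))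
    moreover have "of_real s * z - 1 / (of_real s * z) = - (x / s) * (1 - of_real q * z\<^sup>2)"
      using \<open>z \<noteq> 0\<close> ss by (simp add: x_def field_simps power2_eq_square flip: ss(1))
    moreover have "qpoch_inf (of_real q / (of_real s * z)\<^sup>2) q = (1 - x\<^sup>2) * v"
      unfolding zz(2)[symmetric] using ss by (simp add: power2_eq_square flip: ss(1))
    ultimately have num: "(of_real s * z - 1 / (of_real s * z)) * (qpoch_inf (of_real q * (of_real s * z)\<^sup>2) q *
        qpoch_inf (of_real q / (of_real s * z)\<^sup>2) q) = - (x / s * (1 - x\<^sup>2) * (u * v))"
      by (simp add: mult_ac)
    have *: "s * e * (s * z) = e * z * of_real q" "s * e / (s * z) = e * x" for e :: complex
      using ss by (simp_all add: x_def mult_ac flip: ss(1))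
    have "qpoch_inf (s * e * (s * z)) q = E e z" "qpoch_inf (s * e / (s * z)) q = (1 - e * x) * E e x" for e :: complex
      unfolding * split[symmetric] by (simp_all only: E_def)
    then show ?thesis
      unfolding aw_potential_def num K_def Q_def
      by (simp only: times_divide_eq_left divide_divide_eq_left mult_ac times_divide_eq_right minus_divide_left)
  qed
  have F2: "aw_potential q s a b c d (of_real (1 / s) * z) = z / s * (1 - z\<^sup>2) * K / Q z"
  proof -
    have "qpoch_inf (of_real q / (of_real (1 / s) * z)\<^sup>2) q * (1 - of_real q * x\<^sup>2) = v"
      unfolding v_def by (subst (2) qpoch_inf_step[OF q0 q1]) (simp add: x_def power2_eq_square ss mult_ac flip: ss(1))
    moreover have "of_real (1 / s) * z - 1 / (of_real (1 / s) * z) = z / s * (1 - of_real q * x\<^sup>2)"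
      using \<open>z \<noteq> 0\<close> ss by (simp add: x_def field_simps power2_eq_square flip: ss(1))
    moreover have "qpoch_inf (of_real q * (of_real (1 / s) * z)\<^sup>2) q = (1 - z\<^sup>2) * u"
      unfolding zz(1)[symmetric] using ss by (simp add: power2_eq_square flip: ss(1))
    ultimately have num: "(of_real (1 / s) * z - 1 / (of_real (1 / s) * z)) * (qpoch_inf (of_real q * (of_real (1 / s) * z)\<^sup>2) q *
        qpoch_inf (of_real q / (of_real (1 / s) * z)\<^sup>2) q) = z / s * (1 - z\<^sup>2) * (u * v)"
      by (simp add: mult_ac)
    have *: "s * e * (of_real (1 / s) * z) = e * z" "s * e / (of_real (1 / s) * z) = e * x * of_real q" for e :: complex
      using ss by (simp_all add: x_def mult_ac flip: ss(1))
    have "qpoch_inf (s * e * (of_real (1 / s) * z)) q = (1 - e * z) * E e z"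
        "qpoch_inf (s * e / (of_real (1 / s) * z)) q = E e x" for e :: complex
      unfolding * split[symmetric] by (simp_all only: E_def)
    then show ?thesis
      unfolding aw_potential_def num K_def Q_def
      by (simp only: times_divide_eq_left divide_divide_eq_left mult_ac times_divide_eq_right)
  qed
  define G where "G = (1 - a * b * c * d) * (z + x) - (a + b + c + d - (a * b * c + a * b * d + a * c * d + b * c * d))"
  have factor: "p * (r * w) - t * w = (p * r - t) * w" for p r t w :: complex
    by (simp add: algebra_simps)
  have "(1 - a * b * c * d) * aw_weight q (a * of_real q) b c d z -
      (1 - a * b) * (1 - a * c) * (1 - a * d) * aw_weight q a b c d z = - a * G * aw_weight q a b c d z"
    unfolding Wq G_def aw_contour_identity(1)[OF zx, of a b c d, symmetric] by (rule factor)
  also have "\<dots> = - a * K * ((1 - z\<^sup>2) * (1 - x\<^sup>2) * G) / (Q z * Q x)"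
    unfolding W by simp
  also have "(1 - z\<^sup>2) * (1 - x\<^sup>2) * G = x * (1 - x\<^sup>2) * Q z + z * (1 - z\<^sup>2) * Q x"
    unfolding Q_def G_def by (rule aw_contour_identity(2)[OF zx, symmetric])
  also have "- a * K * (x * (1 - x\<^sup>2) * Q z + z * (1 - z\<^sup>2) * Q x) / (Q z * Q x) =
     a * s * (- (x / s * (1 - x\<^sup>2) * K / Q x) - z / s * (1 - z\<^sup>2) * K / Q z)"
    using Q ss(2) by (simp add: divide_simps) (simp add: algebra_simps)
  finally show ?thesis
    unfolding F1 F2 .
qed

end

context
  fixes q :: real
  assumes q0: "0 < q" and q1: "q < 1"
begin

lemma aw_integral_contiguous:
  fixes a b c d :: complex
  assumes ab: "norm a < 1" "norm b < 1" "norm c < 1" "norm d < 1"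
  shows "(1 - a * b * c * d) * aw_integral q (a * of_real q) b c d =
    (1 - a * b) * (1 - a * c) * (1 - a * d) * aw_integral q a b c d"
proof -
  define s where "s = sqrt q"
  have s: "s > 0" "s\<^sup>2 = q" "s \<le> 1 / s"
    using q0 q1 by (auto simp: s_def field_simps)
  define F where "F = aw_potential q s a b c d"
  define S where "S = {z. z \<noteq> 0 \<and> (\<forall>e\<in>{a, b, c, d}. norm (s * e * z) < 1 \<and> norm (s * e) < norm z)}"
  have S': "S = {z. z \<noteq> 0} \<inter> (\<Inter>e\<in>{a, b, c, d}. {z. norm (s * e * z) < 1} \<inter> {z. norm (s * e) < norm z})"
    by (auto simp: S_def)
  have "open S"
    unfolding S' by (intro open_Int open_INT ballI open_Collect_less open_Collect_neq continuous_intros) auto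
  have F_hol: "F holomorphic_on S"
  proof -
    have nz: "qpoch_inf (s * e * z) q \<noteq> 0" "qpoch_inf (s * e / z) q \<noteq> 0"
      if "z \<in> S" "e \<in> {a, b, c, d}" for z e :: complex
    proof -
      have "z \<noteq> 0" "norm (s * e * z) < 1" "norm (s * e) < norm z"
        using that by (auto simp: S_def simp del: insert_iff)
      moreover from this have "norm (s * e / z) < 1"
        by (simp add: norm_divide)
      ultimately show "qpoch_inf (s * e * z) q \<noteq> 0" "qpoch_inf (s * e / z) q \<noteq> 0"
        by (simp_all add: qpoch_inf_nonzero[OF q0 q1])
    qed
    have S0: "z \<noteq> 0" if "z \<in> S" for z
      using that by (simp add: S_def)
    have hol: "(\<lambda>z. qpoch_inf (s * e * z) q) holomorphic_on S" "(\<lambda>z. qpoch_inf (s * e / z) q) holomorphic_on S" for e :: complex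
      by (rule holomorphic_on_qpoch_inf[OF q0 q1], intro holomorphic_intros S0; simp)+
    have hol': "(\<lambda>z. qpoch_inf (of_real q * z\<^sup>2) q) holomorphic_on S" "(\<lambda>z. qpoch_inf (of_real q / z\<^sup>2) q) holomorphic_on S"
      by (rule holomorphic_on_qpoch_inf[OF q0 q1], intro holomorphic_intros; use S0 in simp)+
    have hol'': "(\<lambda>z. z - 1 / z) holomorphic_on S"
      by (intro holomorphic_intros S0)
    show ?thesis
      unfolding F_def aw_potential_def
      by (intro holomorphic_on_divide[OF holomorphic_on_mult] holomorphic_on_mult hol hol' hol'')
        (simp add: nz)
  qed
  have sub: "z \<in> S" if "s \<le> norm z" "norm z \<le> 1 / s" for z
  proof -
    have bounds: "norm (s * e * z) < 1 \<and> norm (s * e) < norm z" if "norm e < 1" for e :: complex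
    proof
      have "norm (s * e * z) = norm e * (s * norm z)"
        using s by (simp add: norm_mult)
      also have "\<dots> \<le> norm e * 1"
        using \<open>norm z \<le> 1 / s\<close> s by (intro mult_left_mono) (auto simp: field_simps)
      finally show "norm (s * e * z) < 1" using that by simp
      have "norm (s * e) < s"
        using s that by (simp add: norm_mult)
      then show "norm (s * e) < norm z"
        using \<open>s \<le> norm z\<close> by simp
    qed
    have "z \<noteq> 0"
      using \<open>s \<le> norm z\<close> \<open>s > 0\<close> by auto
    moreover have "norm e < 1" if "e \<in> {a, b, c, d}" for e
      using ab that by auto
    ultimately show ?thesis
      unfolding S_def mem_Collect_eq by (intro conjI[OF _ ballI[OF bounds]])
  qed
  have F_int: "(\<lambda>t. F (of_real r * cis t)) integrable_on {-pi..pi}" if "s \<le> r" "r \<le> 1 / s" for r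
  proof (intro integrable_continuous_interval continuous_on_compose2[OF holomorphic_on_imp_continuous_on[OF F_hol]])
    show "(\<lambda>t. of_real r * cis t) ` {-pi..pi} \<subseteq> S"
      using that s by (auto intro!: sub simp: norm_mult)
  qed (intro continuous_intros)
  have "(1 - a * b * c * d) * aw_integral q (a * of_real q) b c d -
      (1 - a * b) * (1 - a * c) * (1 - a * d) * aw_integral q a b c d =
      integral {-pi..pi} (\<lambda>t. (1 - a * b * c * d) * aw_weight q (a * of_real q) b c d (cis t) -
        (1 - a * b) * (1 - a * c) * (1 - a * d) * aw_weight q a b c d (cis t))"
  proof -
    have "norm a * q < 1"
      using ab(1) q0 q1 by (metis abs_of_pos less_1_mult mult_strict_mono' norm_ge_zero less_eq_real_def mult.right_neutral)
    then have "norm (a * of_real q) < 1"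
      using q0 by (simp add: norm_mult)
    then show ?thesis
      unfolding aw_integral_def
      by (subst integral_diff) (use ab in \<open>auto intro!: integrable_on_mult_right aw_weight_integrable[OF q0 q1]\<close>)
  qed
  also have "\<dots> = integral {-pi..pi} (\<lambda>t. a * s * (F (of_real s * cis t) - F (of_real (1 / s) * cis t)))"
    unfolding F_def by (intro integral_cong aw_weight_shift[OF q0 q1] ab s) simp
  also have "\<dots> = a * s * (integral {-pi..pi} (\<lambda>t. F (of_real s * cis t)) - integral {-pi..pi} (\<lambda>t. F (of_real (1 / s) * cis t)))"
    unfolding integral_mult_right using s by (subst integral_diff[OF F_int F_int]) auto
  also have "\<dots> = 0"
    using circle_integral_eq[OF \<open>open S\<close> F_hol s(1,3) sub] by simp
  finally show ?thesis
    by simp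
qed

lemma aw_integral_shift:
  fixes a b c d :: complex
  assumes ab: "norm a < 1" "norm b < 1" "norm c < 1" "norm d < 1"
  shows "qpoch (a * b * c * d) q m * aw_integral q (a * of_real q ^ m) b c d =
    qpoch (a * b) q m * qpoch (a * c) q m * qpoch (a * d) q m * aw_integral q a b c d"
proof (induction m)
  case (Suc m)
  have "norm (a * of_real q ^ m) < 1"
  proof -
    have "norm a * q ^ m \<le> norm a"
      using q0 q1 by (intro mult_left_le power_le_one) auto
    then show ?thesis
      using ab(1) q0 by (simp add: norm_mult norm_power)
  qed
  from aw_integral_contiguous[OF this ab(2-4)]
  have step: "(1 - a * b * c * d * of_real q ^ m) * aw_integral q (a * of_real q ^ Suc m) b c d =
    (1 - a * b * of_real q ^ m) * (1 - a * c * of_real q ^ m) * (1 - a * d * of_real q ^ m) *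
    aw_integral q (a * of_real q ^ m) b c d"
    by (simp add: mult_ac)
  have "qpoch (a * b * c * d) q (Suc m) * aw_integral q (a * of_real q ^ Suc m) b c d =
      (1 - a * b * of_real q ^ m) * (1 - a * c * of_real q ^ m) * (1 - a * d * of_real q ^ m) *
      (qpoch (a * b * c * d) q m * aw_integral q (a * of_real q ^ m) b c d)"
    unfolding qpoch_Suc mult.assoc[of "qpoch (a * b * c * d) q m"] step by (simp only: mult_ac)
  then show ?case
    unfolding Suc.IH qpoch_Suc by (simp only: mult_ac)
qed (simp add: qpoch_def)

lemma aw_integral_limit:
  fixes a b c d :: complex
  assumes ab: "norm a < 1" "norm b < 1" "norm c < 1" "norm d < 1"
  shows "qpoch_inf (a * b * c * d) q * aw_integral q 0 b c d =
    qpoch_inf (a * b) q * qpoch_inf (a * c) q * qpoch_inf (a * d) q * aw_integral q a b c d"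
proof (rule LIMSEQ_unique)
  have "(\<lambda>m. a * of_real q ^ m) \<longlonglongrightarrow> a * 0"
    using q0 q1 by (intro tendsto_intros LIMSEQ_power_zero) auto
  moreover have "isCont (\<lambda>a. aw_integral q a b c d) 0"
    using continuous_on_aw_integral[OF q0 q1 ab(2-4)] by (simp add: continuous_on_eq_continuous_at)
  ultimately have "(\<lambda>m. aw_integral q (a * of_real q ^ m) b c d) \<longlonglongrightarrow> aw_integral q 0 b c d"
    by (auto intro: isCont_tendsto_compose)
  then show "(\<lambda>m. qpoch (a * b * c * d) q m * aw_integral q (a * of_real q ^ m) b c d)
      \<longlonglongrightarrow> qpoch_inf (a * b * c * d) q * aw_integral q 0 b c d"
    by (intro tendsto_intros qpoch_tendsto_qpoch_inf[OF q0 q1])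
  show "(\<lambda>m. qpoch (a * b * c * d) q m * aw_integral q (a * of_real q ^ m) b c d)
      \<longlonglongrightarrow> qpoch_inf (a * b) q * qpoch_inf (a * c) q * qpoch_inf (a * d) q * aw_integral q a b c d"
    unfolding aw_integral_shift[OF ab] by (intro tendsto_intros qpoch_tendsto_qpoch_inf[OF q0 q1])
qed

lemma aw_integral_0:
  fixes a b c d :: complex
  assumes ab: "norm a < 1" "norm b < 1" "norm c < 1" "norm d < 1"
  shows "qpoch_inf (a * b * c * d) q * aw_integral q 0 0 0 0 =
    qpoch_inf (a * b) q * qpoch_inf (a * c) q * qpoch_inf (a * d) q *
    qpoch_inf (b * c) q * qpoch_inf (b * d) q * qpoch_inf (c * d) q * aw_integral q a b c d"
proof -
  have "aw_integral q 0 0 0 0 = aw_integral q 0 0 0 d"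
    using aw_integral_limit[of d 0 0 0] ab by (simp add: aw_integral_perm(3)[of q d])
  also have "\<dots> = qpoch_inf (c * d) q * aw_integral q 0 0 c d"
    using aw_integral_limit[of c 0 0 d] ab by (simp add: aw_integral_perm(2)[of q c])
  also have "aw_integral q 0 0 c d = qpoch_inf (b * c) q * qpoch_inf (b * d) q * aw_integral q 0 b c d"
    using aw_integral_limit[of b 0 c d] ab by (simp add: aw_integral_perm(1)[of q b])
  finally show ?thesis
    using aw_integral_limit[OF ab] by (simp add: mult_ac)
qed

end

context
  fixes q :: real
  assumes q0: "0 < q" and q1: "q < 1"
begin

lemma aw_integral_zero_parameters: "qpoch_inf (of_real q) q * aw_integral q 0 0 0 0 = of_real (4 * pi)"
proof -
  define s where "s = complex_of_real (sqrt q)"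
  define p where "p = complex_of_real q"
  have ss: "s\<^sup>2 = p"
    using q0 by (simp add: s_def p_def flip: of_real_power)
  have norms: "norm s < 1" "norm p < 1"
    using q0 q1 by (auto simp: s_def p_def)
  have P: "qpoch_inf (p * y) q * qpoch_inf (- p * y) q * (qpoch_inf (s * y) q * qpoch_inf (- s * y) q) =
      qpoch_inf (p * y\<^sup>2) q" for y
  proof -
    have "(p * y)\<^sup>2 = p * y\<^sup>2 * of_real q" "(s * y)\<^sup>2 = p * y\<^sup>2"
      using ss by (simp_all add: power_mult_distrib p_def power2_eq_square mult_ac)
    then show ?thesis
      using qpoch_inf_minus[OF q0 q1, of "p * y"] qpoch_inf_minus[OF q0 q1, of "s * y"]
        qpoch_inf_even_odd[OF q0 q1, of "p * y\<^sup>2"] by (simp add: mult.commute)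
  qed
  have weight: "aw_weight q p (- p) s (- s) (cis t) = of_real (2 - 2 * cos (2 * t))" for t
  proof -
    define z where "z = cis t"
    define x where "x = 1 / z"
    have zx: "z * x = 1" "norm z = 1" "norm x = 1" "1 / z\<^sup>2 = x\<^sup>2"
      by (simp_all add: x_def z_def norm_divide power_divide)
    have ez: "e / z = e * x" for e
      by (simp add: x_def)
    have nz: "qpoch_inf (p * y\<^sup>2) q \<noteq> 0" if "norm y = 1" for y
      using that norms by (intro qpoch_inf_nonzero[OF q0 q1]) (simp add: norm_mult norm_power)
    have "aw_weight q p (- p) s (- s) z =
        qpoch_inf (z\<^sup>2) q * qpoch_inf (x\<^sup>2) q / (qpoch_inf (p * z\<^sup>2) q * qpoch_inf (p * x\<^sup>2) q)"
      unfolding aw_weight_def ez zx(4) P[symmetric] by (simp only: mult_ac)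
    also have "\<dots> = (1 - z\<^sup>2) * (1 - x\<^sup>2)"
      using nz[OF zx(2)] nz[OF zx(3)] qpoch_inf_step[OF q0 q1, of "z\<^sup>2"] qpoch_inf_step[OF q0 q1, of "x\<^sup>2"]
      by (simp add: p_def mult_ac)
    also have "\<dots> = 2 - (z\<^sup>2 + x\<^sup>2)"
      using zx(1) by algebra
    also have "\<dots> = of_real (2 - 2 * cos (2 * t))"
    proof -
      have x: "x = cis (- t)"
        by (simp add: x_def z_def flip: cis_inverse inverse_eq_divide)
      show ?thesis
        unfolding x z_def Complex.DeMoivre by (simp add: complex_eq_iff)
    qed
    finally show ?thesis
      by (simp add: z_def)
  qed
  have "aw_integral q p (- p) s (- s) = integral {-pi..pi} (\<lambda>t. of_real (2 - 2 * cos (2 * t)))"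
    unfolding aw_integral_def weight ..
  also have "\<dots> = of_real (4 * pi)"
  proof (rule integral_unique)
    have "((\<lambda>t. 2 - 2 * cos (2 * t)) has_integral (2 * pi - sin (2 * pi)) - (2 * (- pi) - sin (2 * (- pi)))) {-pi..pi}"
      by (rule fundamental_theorem_of_calculus)
        (auto intro!: derivative_eq_intros simp flip: has_real_derivative_iff_has_vector_derivative)
    then show "((\<lambda>t. complex_of_real (2 - 2 * cos (2 * t))) has_integral of_real (4 * pi)) {-pi..pi}"
      by (intro has_integral_of_real) (simp add: sin_2pi_minus)
  qed
  finally have I: "aw_integral q p (- p) s (- s) = of_real (4 * pi)" .
  define C where "C = aw_integral q 0 0 0 0"
  define X Y where "X = qpoch_inf (- p) q" and "Y = qpoch_inf p (q\<^sup>2)"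
  define Y' where "Y' = qpoch_inf (p ^ 3) (q\<^sup>2)"
  have q2: "0 < q\<^sup>2" "q\<^sup>2 < 1"
    using q0 q1 by (auto simp: power_less_one_iff)
  have XY: "X * Y = 1"
    unfolding X_def Y_def p_def by (rule euler_qpoch_inf[OF q0 q1])
  have Y: "Y = (1 - p) * Y'"
    unfolding Y_def Y'_def using qpoch_inf_step[OF q2, of p] by (simp add: p_def power3_eq_cube power2_eq_square mult_ac)
  have X: "X = (1 + p) * qpoch_inf (- p\<^sup>2) q"
    unfolding X_def using qpoch_inf_step[OF q0 q1, of "- p"] by (simp add: p_def power2_eq_square)
  have ps: "qpoch_inf (p * s) q * qpoch_inf (- (p * s)) q = Y'"
    unfolding Y'_def using qpoch_inf_minus[OF q0 q1, of "p * s"] ss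
    by (simp add: power_mult_distrib power2_eq_square power3_eq_cube mult_ac)
  have "qpoch_inf (p ^ 3) q * C = qpoch_inf (- p\<^sup>2) q * (qpoch_inf (p * s) q * qpoch_inf (- (p * s)) q) *
      (qpoch_inf (p * s) q * qpoch_inf (- (p * s)) q) * X * of_real (4 * pi)"
    using aw_integral_0[OF q0 q1, of p "- p" s "- s"] norms unfolding I C_def X_def
    by (simp add: ss[symmetric] power2_eq_square power3_eq_cube mult_ac)
  also have "\<dots> = qpoch_inf (- p\<^sup>2) q * Y' * Y' * X * of_real (4 * pi)"
    unfolding ps ..
  finally have C: "qpoch_inf (p ^ 3) q * C = qpoch_inf (- p\<^sup>2) q * Y' * Y' * X * of_real (4 * pi)" .
  have "qpoch_inf p q = (1 - p) * (1 - p\<^sup>2) * qpoch_inf (p ^ 3) q"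
    using qpoch_inf_split[OF q0 q1, of p 2]
    by (simp add: qpoch_def p_def numeral_2_eq_2 power2_eq_square power3_eq_cube mult_ac)
  then have "qpoch_inf p q * C = (1 - p) * (1 - p\<^sup>2) * (qpoch_inf (p ^ 3) q * C)"
    by simp
  also have "\<dots> = ((1 + p) * qpoch_inf (- p\<^sup>2) q) * ((1 - p) * Y') * X * ((1 - p) * Y') * of_real (4 * pi)"
    unfolding C by (simp add: power2_eq_square algebra_simps)
  also have "\<dots> = of_real (4 * pi)"
    unfolding X[symmetric] Y[symmetric] using XY by (simp add: mult.assoc)
  finally show ?thesis
    by (simp add: C_def p_def)
qed

theorem askey_wilson_integral:
  fixes a b c d :: complex
  assumes "norm a < 1" "norm b < 1" "norm c < 1" "norm d < 1"
  shows "aw_integral q a b c d = of_real (4 * pi) * qpoch_inf (a * b * c * d) q /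
    (qpoch_inf (of_real q) q * (qpoch_inf (a * b) q * qpoch_inf (a * c) q * qpoch_inf (a * d) q *
    qpoch_inf (b * c) q * qpoch_inf (b * d) q * qpoch_inf (c * d) q))"
proof -
  have "qpoch_inf (x * y) q \<noteq> 0" if "norm x < 1" "norm y < 1" for x y
    using that mult_strict_mono'[of "norm x" 1 "norm y" 1] 
    by (intro qpoch_inf_nonzero[OF q0 q1]) (simp add: norm_mult)
  moreover have "qpoch_inf (of_real q) q \<noteq> 0"
    using q0 q1 by (intro qpoch_inf_nonzero) auto
  ultimately show ?thesis
    using aw_integral_0[OF q0 q1 assms] assms unfolding aw_integral_zero_parameters[symmetric]
    by (simp add: eq_divide_eq mult_ac)
qed

end

section \<open>Moments against the q-Hermite weight\<close>

lemma askey_wilson_eq_sum: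
  assumes "0 < q"
  shows "askey_wilson q n t1 t2 t3 t4 x =
    qpoch (t1 * t2) q n * qpoch (t1 * t3) q n * qpoch (t1 * t4) q n * t1 powi (- int n) *
    (\<Sum>k\<le>n. qpoch (of_real q powi (- int n)) q k * qpoch (of_real q powi (int n - 1) * t1 * t2 * t3 * t4) q k /
      (qpoch (of_real q) q k * qpoch (t1 * t2) q k * qpoch (t1 * t3) q k * qpoch (t1 * t4) q k) * of_real q ^ k *
      (qpoch (t1 * cis (arccos x)) q k * qpoch (t1 * cis (- arccos x)) q k))"
proof -
  have "qpoch (of_real q powi (- int n)) q k = 0" if "k > n" for k
  proof -
    have "1 - of_real q powi (- int n) * of_real q ^ n = (0 :: complex)"
      using assms by (simp add: power_int_minus)
    then show ?thesis
      using that unfolding qpoch_def by (intro prod_zero) auto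
  qed
  then show ?thesis
    unfolding askey_wilson_def basic_hyp_def qpochs_def Let_def
    by (subst suminf_finite[of "{..n}"]) (auto simp: mult_ac intro!: sum.cong)
qed

lemma h_fun_2: "h_fun q x [t, u] = h_fun q x [t] * h_fun q x [u]"
  by (simp add: h_fun_def Let_def)

lemma h_fun_cos:
  assumes "\<phi> \<in> {0..pi}"
  shows "h_fun q (cos \<phi>) [t] = qpoch_inf (t * cis \<phi>) q * qpoch_inf (t / cis \<phi>) q"
proof -
  have "t / cis \<phi> = t * cis (- \<phi>)"
    by (simp add: divide_inverse cis_inverse)
  then show ?thesis
    using assms by (simp add: h_fun_def qpochs_inf_def arccos_cos)
qed

context
  fixes q :: real
  assumes q0: "0 < q" and q1: "q < 1"
begin

lemma w_H_cos_times_sin: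
  assumes "\<phi> \<in> {0..pi}"
  shows "w_H q (cos \<phi>) * of_real (sin \<phi>) =
    qpoch_inf (of_real q) q / of_real (2 * pi) * (qpoch_inf ((cis \<phi>)\<^sup>2) q * qpoch_inf (1 / (cis \<phi>)\<^sup>2) q)"
proof (cases "sin \<phi> = 0")
  case True
  then have "(cis \<phi>)\<^sup>2 = 1"
    by (simp add: complex_eq_iff Complex.DeMoivre cos_double sin_double cos_squared_eq)
  moreover have "qpoch_inf 1 q = 0"
    by (subst qpoch_inf_step[OF q0 q1]) simp
  ultimately show ?thesis
    using True by simp
next
  case False
  have "sin \<phi> \<ge> 0"
    using assms by (intro sin_ge_zero) auto
  then have "sqrt (1 - (cos \<phi>)\<^sup>2) = sin \<phi>"
    by (simp flip: sin_squared_eq)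
  moreover have "cis (2 * \<phi>) = (cis \<phi>)\<^sup>2" "cis (- (2 * \<phi>)) = 1 / (cis \<phi>)\<^sup>2"
    by (simp_all add: Complex.DeMoivre flip: cis_inverse inverse_eq_divide)
  ultimately show ?thesis
    using False assms by (simp add: w_H_def arccos_cos qpochs_inf_def mult_ac)
qed

lemma has_integral_aw_weight:
  assumes "norm a < 1" "norm b < 1" "norm c < 1" "norm d < 1"
  shows "((\<lambda>t. aw_weight q a b c d (cis t)) has_integral aw_integral q a b c d / 2) {0..pi}"
proof -
  define f where "f t = aw_weight q a b c d (cis t)" for t
  have int: "f integrable_on {-pi..pi}"
    unfolding f_def using aw_weight_integrable[OF q0 q1 assms] .
  have even: "f (- t) = f t" for t
  proof -
    have "cis (- t) = 1 / cis t"
      by (simp flip: cis_inverse inverse_eq_divide)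
    then show ?thesis
      unfolding f_def aw_weight_def by (simp add: power_divide mult_ac)
  qed
  have f0: "f integrable_on {0..pi}" 
    by (rule integrable_on_subinterval[OF int]) auto
  have "integral {-pi..0} f = integral {0..pi} f"
    using Henstock_Kurzweil_Integration.integral_reflect_real[where a = 0 and b = pi and f = f] by (simp add: even)
  then have "integral {-pi..pi} f = 2 * integral {0..pi} f"
    using Henstock_Kurzweil_Integration.integral_combine[OF _ _ int, of 0] by simp
  then show ?thesis
    using f0 by (simp add: aw_integral_def f_def[symmetric] has_integral_iff)
qed

lemma has_integral_askey_wilson_moment:
  assumes ab: "norm a < 1" "norm b < 1" "norm c < 1" "norm d < 1"
  shows "((\<lambda>\<phi>. w_H q (cos \<phi>) * (qpoch (a * cis \<phi>) q k * qpoch (a * cis (- \<phi>)) q k) * of_real (sin \<phi>) /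
      (h_fun q (cos \<phi>) [c, d] * h_fun q (cos \<phi>) [a, b])) has_integral
    qpoch_inf (a * b * c * d * of_real q ^ k) q / (qpoch_inf (a * b * of_real q ^ k) q *
      qpoch_inf (a * c * of_real q ^ k) q * qpoch_inf (a * d * of_real q ^ k) q *
      qpoch_inf (b * c) q * qpoch_inf (b * d) q * qpoch_inf (c * d) q)) {0..pi}"
proof -
  define a' where "a' = a * of_real q ^ k"
  have a': "norm a' < 1"
  proof -
    have "norm a * q ^ k \<le> norm a"
      using q0 q1 by (intro mult_left_le power_le_one) auto
    then show ?thesis
      using ab(1) q0 by (simp add: a'_def norm_mult norm_power)
  qed
  have Pq: "qpoch_inf (of_real q) q \<noteq> 0"
    using q0 q1 by (intro qpoch_inf_nonzero) auto
  have eq: "w_H q (cos \<phi>) * (qpoch (a * cis \<phi>) q k * qpoch (a * cis (- \<phi>)) q k) * of_real (sin \<phi>) /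
      (h_fun q (cos \<phi>) [c, d] * h_fun q (cos \<phi>) [a, b]) =
      qpoch_inf (of_real q) q / of_real (2 * pi) * aw_weight q a' b c d (cis \<phi>)" if \<phi>: "\<phi> \<in> {0..pi}" for \<phi>
  proof -
    have cis: "cis (- \<phi>) = 1 / cis \<phi>"
      by (simp flip: cis_inverse inverse_eq_divide)
    have nz: "qpoch (a * cis \<phi>) q k \<noteq> 0" "qpoch (a / cis \<phi>) q k \<noteq> 0"
      using ab(1) by (auto intro!: qpoch_nonzero[OF q0 q1] simp: norm_mult norm_divide)
    have split: "qpoch_inf (a * cis \<phi>) q = qpoch (a * cis \<phi>) q k * qpoch_inf (a' * cis \<phi>) q"
        "qpoch_inf (a / cis \<phi>) q = qpoch (a / cis \<phi>) q k * qpoch_inf (a' / cis \<phi>) q"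
      using qpoch_inf_split[OF q0 q1, of "a * cis \<phi>" k] qpoch_inf_split[OF q0 q1, of "a / cis \<phi>" k]
      by (simp_all add: a'_def mult_ac)
    have cancel: "W * (p * r) * S / (C * D * (p * X * (r * Y) * B)) = W * S / (X * Y * B * C * D)"
      if "p \<noteq> 0" "r \<noteq> 0" for W p r S B C D X Y :: complex
      using that by simp
    have "w_H q (cos \<phi>) * (qpoch (a * cis \<phi>) q k * qpoch (a * cis (- \<phi>)) q k) * of_real (sin \<phi>) /
        (h_fun q (cos \<phi>) [c, d] * h_fun q (cos \<phi>) [a, b]) =
        w_H q (cos \<phi>) * (qpoch (a * cis \<phi>) q k * qpoch (a / cis \<phi>) q k) * of_real (sin \<phi>) /
        (h_fun q (cos \<phi>) [c] * h_fun q (cos \<phi>) [d] * (qpoch (a * cis \<phi>) q k * qpoch_inf (a' * cis \<phi>) q *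
        (qpoch (a / cis \<phi>) q k * qpoch_inf (a' / cis \<phi>) q) * h_fun q (cos \<phi>) [b]))"
      unfolding h_fun_2 h_fun_cos[OF \<phi>, of q a] split cis by simp
    also have "\<dots> = w_H q (cos \<phi>) * of_real (sin \<phi>) / (qpoch_inf (a' * cis \<phi>) q * qpoch_inf (a' / cis \<phi>) q *
        h_fun q (cos \<phi>) [b] * h_fun q (cos \<phi>) [c] * h_fun q (cos \<phi>) [d])"
      using nz by (rule cancel)
    also have "\<dots> = qpoch_inf (of_real q) q / of_real (2 * pi) * aw_weight q a' b c d (cis \<phi>)"
      unfolding w_H_cos_times_sin[OF \<phi>] h_fun_cos[OF \<phi>] aw_weight_def
      by (simp only: times_divide_eq_right)
    finally show ?thesis .
  qed
  have val: "qpoch_inf (of_real q) q / of_real (2 * pi) * (aw_integral q a' b c d / 2) =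
    qpoch_inf (a * b * c * d * of_real q ^ k) q / (qpoch_inf (a * b * of_real q ^ k) q *
      qpoch_inf (a * c * of_real q ^ k) q * qpoch_inf (a * d * of_real q ^ k) q *
      qpoch_inf (b * c) q * qpoch_inf (b * d) q * qpoch_inf (c * d) q)"
    by (subst askey_wilson_integral[OF q0 q1 a' ab(2-4)]) (use Pq in \<open>simp add: a'_def mult_ac\<close>)
  show ?thesis
    using has_integral_mult_right[OF has_integral_aw_weight[OF a' ab(2-4)], of "qpoch_inf (of_real q) q / of_real (2 * pi)"]
    unfolding val by (rule has_integral_eq[rotated]) (simp add: eq)
qed

end

theorem mainTheorem10:
  fixes q a \<theta> :: real and c a3 a4 :: complex and n :: nat
  assumes "0 < q" and "q < 1" and "a > 0"
    and "1 < norm c" and "norm c < 1 / q"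
  shows "K_op q a c (askey_wilson q n (- 1 / c) (- c * of_real q) a3 a4) (cos \<theta>) =
    of_real (q powr (a * (a - 3) / 4 + real n * a / 2)) * (of_real (1 - q) / (2 * c)) powr of_real a *
    (qpoch (of_real q) q n / qpoch (of_real (q powr (a + 1))) q n) *
    (qpoch_inf (of_real (q powr (a + 1))) q / qpoch_inf (of_real q) q) *
    (h_fun q (cos \<theta>) [- of_real (q powr (1 - a / 2)) * c] /
     h_fun q (cos \<theta>) [- c * of_real (q powr (1 + a / 2))]) *
    askey_wilson q n (- of_real (q powr (a / 2)) / c) (- c * of_real (q powr (1 + a / 2)))
      (of_real (q powr (- a / 2)) * a3) (of_real (q powr (- a / 2)) * a4) (cos \<theta>)"
proof -
  note q = assms(1,2)
  define \<tau> where "\<tau> = arccos (cos \<theta>)"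
  define t1 t2 where "t1 = - 1 / c" and "t2 = - c * of_real q"
  define A where "A = complex_of_real (q powr (a / 2))"
  define B1 B2 where "B1 = A * cis \<tau>" and "B2 = A * cis (- \<tau>)"
  define Q where "Q = complex_of_real (q powr (a + 1))"
  have c0: "c \<noteq> 0" using assms(4) by auto
  have A0: "A \<noteq> 0" using q by (simp add: A_def)
  have nA: "norm A < 1"
    using q assms(3) by (simp add: A_def powr_def mult_pos_neg)
  have norms: "norm t1 < 1" "norm t2 < 1" "norm B1 < 1" "norm B2 < 1"
    using assms nA by (auto simp: t1_def t2_def B1_def B2_def norm_mult norm_divide divide_less_eq less_divide_eq)
  have t12: "t1 * t2 = of_real q"
    using c0 by (simp add: t1_def t2_def)
  have BB: "B1 * B2 = A * A" 
    by (simp add: B1_def B2_def cis_mult mult_ac)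
  have AA: "A * A = of_real (q powr a)"
    by (simp add: A_def flip: of_real_mult powr_add)
  have qAA: "of_real q * (A * A) = Q"
    unfolding AA Q_def using q by (simp add: powr_add mult.commute)
  have T1: "- of_real (q powr (a / 2)) / c = A * t1"
    by (simp add: A_def t1_def)
  have T2: "- c * of_real (q powr (1 + a / 2)) = A * t2"
    using q by (simp add: A_def t2_def powr_add mult_ac)
  have A': "of_real (q powr (- a / 2)) = 1 / A"
    using powr_minus[of q "a / 2"] by (simp add: A_def inverse_eq_divide)
  have TT: "A * t1 * (A * t2) = Q" "A * t1 * (1 / A * a3) = t1 * a3" "A * t1 * (1 / A * a4) = t1 * a4"
      "r * (A * t1) * (A * t2) * (1 / A * a3) * (1 / A * a4) = r * t1 * t2 * a3 * a4" for r
    using A0 qAA t12 by (simp_all add: mult_ac)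
  have Tcis: "A * t1 * cis \<tau> = t1 * B1" "A * t1 * cis (- \<tau>) = t1 * B2"
      "A * t2 * cis \<tau> = t2 * B1" "A * t2 * cis (- \<tau>) = t2 * B2"
    by (simp_all add: B1_def B2_def)
  have prod_norm: "norm (x * y) < 1" if "norm x < 1" "norm y < 1" for x y :: complex
    using that mult_strict_mono'[of "norm x" 1 "norm y" 1] by (simp add: norm_mult)
  have nQ: "norm Q < 1"
    using prod_norm[OF norms(1,2)] prod_norm[OF nA nA] prod_norm[of "of_real q" "A * A"] unfolding t12 qAA by blast
  have nq: "norm (complex_of_real q) < 1"
    using q by simp

  define coef where "coef k = qpoch (of_real q powi (- int n)) q k *
      qpoch (of_real q powi (int n - 1) * t1 * t2 * a3 * a4) q k /
      (qpoch (of_real q) q k * qpoch (t1 * t2) q k * qpoch (t1 * a3) q k * qpoch (t1 * a4) q k) * of_real q ^ k" for k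
  define pre where "pre = qpoch (t1 * t2) q n * qpoch (t1 * a3) q n * qpoch (t1 * a4) q n * t1 powi (- int n)"
  define R where "R = qpoch_inf Q q / (qpoch_inf (of_real q) q *
      (qpoch_inf (t1 * B1) q * qpoch_inf (t1 * B2) q) * (qpoch_inf (t2 * B1) q * qpoch_inf (t2 * B2) q))"
  define D where "D k = qpoch (of_real q) q k * (qpoch (t1 * B1) q k * qpoch (t1 * B2) q k) / qpoch Q q k" for k
  define S where "S = (\<Sum>k\<le>n. coef k * D k)"

  have qa: "qpoch_inf (B1 * B2) q \<noteq> 0"
    by (intro qpoch_inf_nonzero[OF q] prod_norm norms)
  have moment: "((\<lambda>\<phi>. w_H q (cos \<phi>) * (qpoch (t1 * cis \<phi>) q k * qpoch (t1 * cis (- \<phi>)) q k) * of_real (sin \<phi>) /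
      (h_fun q (cos \<phi>) [B1, B2] * h_fun q (cos \<phi>) [t1, t2])) has_integral
      R * D k / qpoch_inf (B1 * B2) q) {0..pi}" for k
  proof -
    have split: "qpoch_inf (x * of_real q ^ k) q = qpoch_inf x q / qpoch x q k" if "norm x < 1" for x
      using qpoch_inf_split[OF q, of x k] qpoch_nonzero[OF q that] by simp
    have "qpoch_inf (t1 * t2 * B1 * B2 * of_real q ^ k) q / (qpoch_inf (t1 * t2 * of_real q ^ k) q *
        qpoch_inf (t1 * B1 * of_real q ^ k) q * qpoch_inf (t1 * B2 * of_real q ^ k) q *
        qpoch_inf (t2 * B1) q * qpoch_inf (t2 * B2) q * qpoch_inf (B1 * B2) q) = R * D k / qpoch_inf (B1 * B2) q"
    proof -
      have Q: "t1 * t2 * B1 * B2 = Q"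
        unfolding qAA[symmetric] t12[symmetric] BB[symmetric] by simp
      show ?thesis
        unfolding Q unfolding t12 split[OF nQ] split[OF nq] split[OF prod_norm[OF norms(1,3)]]
          split[OF prod_norm[OF norms(1,4)]] R_def D_def by (simp add: mult_ac)
    qed
    then show ?thesis
      using has_integral_askey_wilson_moment[OF q norms, of k] by simp
  qed

  have "((\<lambda>\<phi>. w_H q (cos \<phi>) * qpoch_inf (of_real (q powr a)) q * askey_wilson q n t1 t2 a3 a4 (cos \<phi>) *
      of_real (sin \<phi>) / (h_fun q (cos \<phi>) [B1, B2] * h_fun q (cos \<phi>) [t1, t2])) has_integral
      (\<Sum>k\<le>n. qpoch_inf (B1 * B2) q * pre * coef k * (R * D k / qpoch_inf (B1 * B2) q))) {0..pi}"
  proof (rule has_integral_eq[rotated])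
    show "((\<lambda>\<phi>. \<Sum>k\<le>n. qpoch_inf (B1 * B2) q * pre * coef k *
        (w_H q (cos \<phi>) * (qpoch (t1 * cis \<phi>) q k * qpoch (t1 * cis (- \<phi>)) q k) * of_real (sin \<phi>) /
        (h_fun q (cos \<phi>) [B1, B2] * h_fun q (cos \<phi>) [t1, t2]))) has_integral
      (\<Sum>k\<le>n. qpoch_inf (B1 * B2) q * pre * coef k * (R * D k / qpoch_inf (B1 * B2) q))) {0..pi}"
      by (intro has_integral_sum has_integral_mult_right moment) auto
    fix \<phi> assume \<phi>: "\<phi> \<in> {0..pi}"
    have p: "askey_wilson q n t1 t2 a3 a4 (cos \<phi>) =
        pre * (\<Sum>k\<le>n. coef k * (qpoch (t1 * cis \<phi>) q k * qpoch (t1 * cis (- \<phi>)) q k))"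
      using \<phi> unfolding askey_wilson_eq_sum[OF q(1)] pre_def coef_def by (simp add: arccos_cos)
    show "(\<Sum>k\<le>n. qpoch_inf (B1 * B2) q * pre * coef k *
        (w_H q (cos \<phi>) * (qpoch (t1 * cis \<phi>) q k * qpoch (t1 * cis (- \<phi>)) q k) * of_real (sin \<phi>) /
        (h_fun q (cos \<phi>) [B1, B2] * h_fun q (cos \<phi>) [t1, t2]))) =
      w_H q (cos \<phi>) * qpoch_inf (of_real (q powr a)) q * askey_wilson q n t1 t2 a3 a4 (cos \<phi>) *
      of_real (sin \<phi>) / (h_fun q (cos \<phi>) [B1, B2] * h_fun q (cos \<phi>) [t1, t2])"
      unfolding p BB AA sum_distrib_left sum_distrib_right sum_divide_distrib
      by (intro sum.cong refl) (simp add: mult_ac)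
  qed
  also have "(\<Sum>k\<le>n. qpoch_inf (B1 * B2) q * pre * coef k * (R * D k / qpoch_inf (B1 * B2) q)) = pre * R * S"
    using qa by (simp add: S_def sum_distrib_left mult_ac)
  finally have int: "integral {0..pi} (\<lambda>\<phi>. w_H q (cos \<phi>) * qpoch_inf (of_real (q powr a)) q *
      askey_wilson q n t1 t2 a3 a4 (cos \<phi>) * of_real (sin \<phi>) /
      (h_fun q (cos \<phi>) [B1, B2] * h_fun q (cos \<phi>) [t1, t2])) = pre * R * S"
    by (rule integral_unique)

  define W where "W = (of_real (1 - q) / (2 * c)) powr complex_of_real a"
  define H where "H = h_fun q (cos \<theta>) [- of_real (q powr (1 - a / 2)) * c]"
  have h1: "h_fun q (cos \<theta>) [A * t1] = qpoch_inf (t1 * B1) q * qpoch_inf (t1 * B2) q"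
    and h2: "h_fun q (cos \<theta>) [A * t2] = qpoch_inf (t2 * B1) q * qpoch_inf (t2 * B2) q"
    by (simp_all add: h_fun_def qpochs_inf_def Let_def Tcis[unfolded \<tau>_def] \<tau>_def[symmetric] Tcis)
  have K: "K_op q a c (askey_wilson q n t1 t2 a3 a4) (cos \<theta>) =
      of_real (q powr (a * (a - 3) / 4)) * W * (H * h_fun q (cos \<theta>) [A * t1]) * (pre * R * S)"
    unfolding K_op_def Let_def \<tau>_def[symmetric] h_fun_2 T1 W_def H_def
    using int[unfolded h_fun_2] by (simp add: B1_def B2_def A_def t1_def t2_def mult_ac)

  have sumS: "askey_wilson q n (A * t1) (A * t2) (1 / A * a3) (1 / A * a4) (cos \<theta>) =
      qpoch Q q n * qpoch (t1 * a3) q n * qpoch (t1 * a4) q n * (A * t1) powi (- int n) * S"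
  proof -
    have "coef k * D k = qpoch (of_real q powi (- int n)) q k *
        qpoch (of_real q powi (int n - 1) * t1 * t2 * a3 * a4) q k /
        (qpoch (of_real q) q k * qpoch Q q k * qpoch (t1 * a3) q k * qpoch (t1 * a4) q k) * of_real q ^ k *
        (qpoch (t1 * B1) q k * qpoch (t1 * B2) q k)" for k
      unfolding coef_def D_def t12 using qpoch_nonzero[OF q nq, of k] by (simp add: mult_ac)
    then show ?thesis
      unfolding askey_wilson_eq_sum[OF q(1)] TT S_def \<tau>_def[symmetric] Tcis by simp
  qed
  have powA: "of_real (q powr (a * (a - 3) / 4 + real n * a / 2)) * (A * t1) powi (- int n) =
      of_real (q powr (a * (a - 3) / 4)) * t1 powi (- int n)"
  proof -
    have An: "complex_of_real (q powr (real n * a / 2)) = A ^ n"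
      using q by (simp add: A_def powr_powr mult_ac flip: of_real_power powr_realpow)
    show ?thesis
      unfolding powr_add of_real_mult An using A0 by (simp add: power_int_minus power_mult_distrib)
  qed
  have nz: "qpoch_inf (t1 * B1) q \<noteq> 0" "qpoch_inf (t1 * B2) q \<noteq> 0" "qpoch Q q n \<noteq> 0"
    by (intro qpoch_inf_nonzero[OF q] qpoch_nonzero[OF q] prod_norm norms nQ)+
  have final: "X * W * (H * (u * v)) * (P * p3 * p4 * tn * (PQ / (Pq * (u * v) * (u' * v'))) * S) =
      X' * W * (P / P') * (PQ / Pq) * (H / (u' * v')) * (P' * p3 * p4 * tn' * S)"
    if "X' * tn' = X * tn" "u \<noteq> 0" "v \<noteq> 0" "P' \<noteq> 0"
    for X u v P p3 p4 tn PQ Pq u' v' X' P' tn' :: complex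
  proof -
    have "X * W * (H * (u * v)) * (P * p3 * p4 * tn * (PQ / (Pq * (u * v) * (u' * v'))) * S) =
        (X * tn) * (W * H * P * p3 * p4 * S * PQ / (Pq * (u' * v')))"
      using that(2-4) by simp
    also have "\<dots> = X' * W * (P / P') * (PQ / Pq) * (H / (u' * v')) * (P' * p3 * p4 * tn' * S)"
      unfolding that(1)[symmetric] using that(2-4) by simp
    finally show ?thesis .
  qed
  show ?thesis
    unfolding T1 T2 A' t1_def[symmetric] t2_def[symmetric] K sumS h1 h2 W_def[symmetric] H_def[symmetric]
      Q_def[symmetric] pre_def R_def t12
    using powA nz by (rule final)
qed

end
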